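(* Let $K$ be an imperfect field of characteristic $2$ and $L$ an additive subgroup of $K$ with $K^2\le L\le K$ which is a vector space over $K^2$. Let $\mathrm{SL}_2(L)$, $A$, $T(L)$, $T(K)$ be as described below, and let $T$ be a group with $T(L)\le T\le T(K)$. Let \[\bar T=\{c\in K\mid \text{there is } h\in T \text{ with } h\,a(x)\,h^{-1}=a(cx)\text{ for all }x\in L\},\] and let $G=T\,\mathrm{SL}_2(L)$. Then: (1) the group $G$ is definable (interpretable) in the structure $(L,\bar T,\cdot,\sigma)$, where $\cdot$ is the multiplication map $\bar T\times L\to L$ and $\sigma$ is the squaring map $x\mapsto x^2$ on $L$; (2) conversely, this structure is definable (interpretable) in the group $G$.
   Context: $a(t)=\begin{pmatrix}1&t\\0&1\end{pmatrix}$, $b(t)=\begin{pmatrix}1&0\\t&1\end{pmatrix}$; $\mathrm{SL}_2(L)$ is the subgroup of $\mathrm{SL}_2(K)$ generated by $a(t),b(t)$ for $t\in L$; $A=\{a(t):t\in L\}$; $T(K)$ is the group of diagonal matrices of $\mathrm{SL}_2(K)$; $T(L)$ is the group of matrices $\mathrm{Diag}(s,s^{-1})$ with $s$ in the multiplicative subgroup of $K^\times$ generated by $L\setminus\{0\}$. *)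

theory Defs
  imports "HOL-Analysis.Determinants" "HOL-Algebra.Generated_Groups"
    "HOL-Computational_Algebra.Computational_Algebra"
begin

section \<open>Many-sorted first-order structures and definability\<close>

text \<open>
  A structure has sorts \<open>'s\<close>, function symbols \<open>'f\<close> and elements drawn from \<open>'a\<close>; equality is the
  only relation symbol. Distinct sorts may have overlapping universes in \<open>'a\<close>, but well-formed
  formulas never compare elements of distinct sorts, so such an overlap is invisible to the
  structure.
\<close>

record ('s, 'f, 'a) fo_struct =
  univ :: "'s \<Rightarrow> 'a set"
  args :: "'f \<Rightarrow> 's list"
  res :: "'f \<Rightarrow> 's"
  interp :: "'f \<Rightarrow> 'a list \<Rightarrow> 'a"

datatype ('s, 'f) fo_term =
  Var 's nat
| App 'f "('s, 'f) fo_term list"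

datatype ('s, 'f) fo_form =
  Eq "('s, 'f) fo_term" "('s, 'f) fo_term"
| Neg "('s, 'f) fo_form"
| Conj "('s, 'f) fo_form" "('s, 'f) fo_form"
| Ex 's nat "('s, 'f) fo_form"

fun sort_of :: "('s, 'f, 'a) fo_struct \<Rightarrow> ('s, 'f) fo_term \<Rightarrow> 's" where
  "sort_of M (Var s n) = s"
| "sort_of M (App f ts) = res M f"

fun wf_term :: "('s, 'f, 'a) fo_struct \<Rightarrow> ('s, 'f) fo_term \<Rightarrow> bool" where
  "wf_term M (Var s n) \<longleftrightarrow> True"
| "wf_term M (App f ts) \<longleftrightarrow> map (sort_of M) ts = args M f \<and> (\<forall>t\<in>set ts. wf_term M t)"

fun wf_form :: "('s, 'f, 'a) fo_struct \<Rightarrow> ('s, 'f) fo_form \<Rightarrow> bool" where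
  "wf_form M (Eq t u) \<longleftrightarrow> wf_term M t \<and> wf_term M u \<and> sort_of M t = sort_of M u"
| "wf_form M (Neg \<phi>) \<longleftrightarrow> wf_form M \<phi>"
| "wf_form M (Conj \<phi> \<psi>) \<longleftrightarrow> wf_form M \<phi> \<and> wf_form M \<psi>"
| "wf_form M (Ex s n \<phi>) \<longleftrightarrow> wf_form M \<phi>"

fun eval_term :: "('s, 'f, 'a) fo_struct \<Rightarrow> ('s \<Rightarrow> nat \<Rightarrow> 'a) \<Rightarrow> ('s, 'f) fo_term \<Rightarrow> 'a" where
  "eval_term M e (Var s n) = e s n"
| "eval_term M e (App f ts) = interp M f (map (eval_term M e) ts)"

fun sat :: "('s, 'f, 'a) fo_struct \<Rightarrow> ('s \<Rightarrow> nat \<Rightarrow> 'a) \<Rightarrow> ('s, 'f) fo_form \<Rightarrow> bool" where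
  "sat M e (Eq t u) \<longleftrightarrow> eval_term M e t = eval_term M e u"
| "sat M e (Neg \<phi>) \<longleftrightarrow> \<not> sat M e \<phi>"
| "sat M e (Conj \<phi> \<psi>) \<longleftrightarrow> sat M e \<phi> \<and> sat M e \<psi>"
| "sat M e (Ex s n \<phi>) \<longleftrightarrow> (\<exists>x\<in>univ M s. sat M (e(s := (e s)(n := x))) \<phi>)"

definition tuples :: "('s, 'f, 'a) fo_struct \<Rightarrow> 's list \<Rightarrow> 'a list set" where
  "tuples M ss = {xs. list_all2 (\<lambda>x s. x \<in> univ M s) xs ss}"

text \<open>The \<open>i\<close>-th entry of a tuple of sorts \<open>ss\<close> is the value of the variable \<open>Var (ss ! i) i\<close>.\<close>

definition assign :: "'s list \<Rightarrow> 'a list \<Rightarrow> ('s \<Rightarrow> nat \<Rightarrow> 'a) \<Rightarrow> 's \<Rightarrow> nat \<Rightarrow> 'a" where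
  "assign ss xs e = (\<lambda>s n. if n < length ss \<and> ss ! n = s then xs ! n else e s n)"

text \<open>
  Definability with parameters: the parameters are the values that \<open>e\<close> gives to the free variables
  of \<open>\<phi>\<close> which are not tuple variables.
\<close>

definition definable :: "('s, 'f, 'a) fo_struct \<Rightarrow> 's list \<Rightarrow> 'a list set \<Rightarrow> bool" where
  "definable M ss X \<longleftrightarrow>
     (\<exists>\<phi> e. wf_form M \<phi> \<and> (\<forall>s n. e s n \<in> univ M s) \<and>
        X = {xs \<in> tuples M ss. sat M (assign ss xs e) \<phi>})"

text \<open>
  An interpretation of \<open>N\<close> in \<open>M\<close>: elements of sort \<open>s\<close> of \<open>N\<close> are coded, via the surjection \<open>\<pi> s\<close>,
  by tuples in a definable set \<open>D s\<close> of tuples of sorts \<open>idx s\<close> of \<open>M\<close>, such that the preimages of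
  equality and of the graphs of the operations of \<open>N\<close> are definable in \<open>M\<close>.
\<close>

definition interpretation_in ::
  "('t, 'g, 'b) fo_struct \<Rightarrow> ('s, 'f, 'a) fo_struct \<Rightarrow>
   ('t \<Rightarrow> 's list) \<Rightarrow> ('t \<Rightarrow> 'a list set) \<Rightarrow> ('t \<Rightarrow> 'a list \<Rightarrow> 'b) \<Rightarrow> bool" where
  "interpretation_in N M idx D \<pi> \<longleftrightarrow>
     (\<forall>s. definable M (idx s) (D s) \<and> \<pi> s ` D s = univ N s \<and>
        definable M (idx s @ idx s)
          {xs @ ys | xs ys. xs \<in> D s \<and> ys \<in> D s \<and> \<pi> s xs = \<pi> s ys}) \<and>
     (\<forall>f. definable M (concat (map idx (args N f)) @ idx (res N f))
        {concat xss @ ys | xss ys.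
           list_all2 (\<lambda>xs s. xs \<in> D s) xss (args N f) \<and> ys \<in> D (res N f) \<and>
           \<pi> (res N f) ys = interp N f (map2 \<pi> (args N f) xss)})"

definition interpretable_in ::
  "('t, 'g, 'b) fo_struct \<Rightarrow> ('s, 'f, 'a) fo_struct \<Rightarrow> bool" where
  "interpretable_in N M \<longleftrightarrow> (\<exists>idx D \<pi>. interpretation_in N M idx D \<pi>)"

text \<open>
  \<open>N\<close> is definable in \<open>M\<close> if it is isomorphic to a structure whose universes are definable sets of
  tuples of \<open>M\<close> (no quotients are taken) and whose operations have definable graphs.
\<close>

definition definable_in ::
  "('t, 'g, 'b) fo_struct \<Rightarrow> ('s, 'f, 'a) fo_struct \<Rightarrow> bool" where
  "definable_in N M \<longleftrightarrow>
     (\<exists>idx D \<pi>. interpretation_in N M idx D \<pi> \<and> (\<forall>s. inj_on (\<pi> s) (D s)))"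

lemma definable_in_imp_interpretable_in: "definable_in N M \<Longrightarrow> interpretable_in N M"
  by (auto simp: definable_in_def interpretable_in_def)

datatype grp_op = Mult

text \<open>Identity and inversion are definable from multiplication.\<close>

definition group_struct :: "('a, 'm) monoid_scheme \<Rightarrow> (unit, grp_op, 'a) fo_struct" where
  "group_struct G =
     \<lparr>univ = (\<lambda>_. carrier G), args = (\<lambda>_. [(), ()]), res = (\<lambda>_. ()),
      interp = (\<lambda>_ xs. xs ! 0 \<otimes>\<^bsub>G\<^esub> xs ! 1)\<rparr>"

section \<open>The groups\<close>

definition a_mat :: "'k::field \<Rightarrow> 'k^2^2" where
  "a_mat t = vector [vector [1, t], vector [0, 1]]"

definition b_mat :: "'k::field \<Rightarrow> 'k^2^2" where
  "b_mat t = vector [vector [1, 0], vector [t, 1]]"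

definition Diag :: "'k::field \<Rightarrow> 'k \<Rightarrow> 'k^2^2" where
  "Diag x y = vector [vector [x, 0], vector [0, y]]"

definition SL2 :: "('k::field^2^2) monoid" where
  "SL2 = \<lparr>carrier = {M. det M = 1}, mult = (**), one = mat 1\<rparr>"

definition mult_group :: "'k::field monoid" where
  "mult_group = \<lparr>carrier = UNIV - {0}, mult = (*), one = 1\<rparr>"

definition SL2_sub :: "'k::field set \<Rightarrow> ('k^2^2) set" where
  "SL2_sub L = generate SL2 (a_mat ` L \<union> b_mat ` L)"

definition T_full :: "('k::field^2^2) set" where
  "T_full = {M \<in> carrier SL2. \<exists>x y. M = Diag x y}"

definition T_sub :: "'k::field set \<Rightarrow> ('k^2^2) set" where
  "T_sub L = {Diag s (inverse s) | s. s \<in> generate mult_group (L - {0})}"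

definition T_bar :: "'k::field set \<Rightarrow> ('k^2^2) set \<Rightarrow> 'k set" where
  "T_bar L T = {c. \<exists>h\<in>T. \<forall>x\<in>L. h \<otimes>\<^bsub>SL2\<^esub> a_mat x \<otimes>\<^bsub>SL2\<^esub> inv\<^bsub>SL2\<^esub> h = a_mat (c * x)}"

definition G_group :: "'k::field set \<Rightarrow> ('k^2^2) set \<Rightarrow> ('k^2^2) monoid" where
  "G_group L T = SL2\<lparr>carrier := T <#>\<^bsub>SL2\<^esub> SL2_sub L\<rparr>"

section \<open>The structure on $(L, \bar T)$\<close>

datatype lt_sort = SortL | SortT

datatype lt_op = Add | Act | Sq

text \<open>
  The two-sorted structure consisting of the additive group \<open>L\<close>, the set \<open>\<bar>T\<close>, the
  multiplication map from \<open>\<bar>T \<times> L\<close> to \<open>L\<close>, and squaring on \<open>L\<close>. The group law of \<open>\<bar>T\<close> and its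
  inclusion in \<open>L\<close> are not part of the language; both are definable from the multiplication map
  (and from \<open>1 \<in> L\<close>).
\<close>

definition LT_struct :: "'k::field set \<Rightarrow> 'k set \<Rightarrow> (lt_sort, lt_op, 'k) fo_struct" where
  "LT_struct L Tb =
     \<lparr>univ = (\<lambda>s. case s of SortL \<Rightarrow> L | SortT \<Rightarrow> Tb),
      args = (\<lambda>f. case f of Add \<Rightarrow> [SortL, SortL] | Act \<Rightarrow> [SortT, SortL] | Sq \<Rightarrow> [SortL]),
      res = (\<lambda>_. SortL),
      interp = (\<lambda>f xs. case f of Add \<Rightarrow> xs ! 0 + xs ! 1 | Act \<Rightarrow> xs ! 0 * xs ! 1
                            | Sq \<Rightarrow> (xs ! 0)\<^sup>2)\<rparr>"

text \<open>A field of characteristic 2 is imperfect iff its Frobenius map is not onto.\<close>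

definition imperfect_char2 :: "'k::field itself \<Rightarrow> bool" where
  "imperfect_char2 _ \<longleftrightarrow> CHAR('k) = 2 \<and> range (\<lambda>x::'k. x\<^sup>2) \<noteq> UNIV"

definition is_add_subgroup :: "'k::field set \<Rightarrow> bool" where
  "is_add_subgroup L \<longleftrightarrow> 0 \<in> L \<and> (\<forall>x\<in>L. \<forall>y\<in>L. x + y \<in> L) \<and> (\<forall>x\<in>L. - x \<in> L)"

end

theory Submission
  imports Defs
begin

text \<open>
  Write \<open>T = {Diag s s\<inverse> | s \<in> S}\<close>, so that \<open>\<bar>T = S\<^sup>2\<close> and \<open>L - {0} \<subseteq> S\<close>. The group \<open>G\<close> consists of the
  matrices of determinant \<open>1\<close> with entries in \<open>S \<union> {0}\<close> for which the product of any two entries in the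
  same row or column lies in \<open>L\<close>. Squaring the entries embeds \<open>G\<close> into \<open>L\<^sup>4\<close>, because \<open>K\<^sup>2 \<subseteq> L\<close>. The
  image and the transported group law are definable, since the ternary relation \<open>x y = z\<close> on \<open>L\<close> is:
  it amounts to \<open>x\<^sup>2 y\<^sup>2 = z\<^sup>2\<close>, and \<open>x\<^sup>2 \<in> \<bar>T\<close> for \<open>x \<noteq> 0\<close>.

  Conversely, \<open>L\<close> and \<open>\<bar>T\<close> are recovered as the centralizers \<open>A\<close> of \<open>a(1)\<close> and \<open>T\<close> of a nontrivial
  diagonal matrix, addition as multiplication in \<open>A\<close> and the action as conjugation. For squaring one
  defines \<open>Diag x x\<inverse>\<close> from \<open>a(x)\<close> as the only diagonal matrix of the form \<open>a(x) b(u) a(x) w\<close>, where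
  \<open>w\<close> is the Weyl element \<open>a(1) b(1) a(1)\<close>, and conjugates \<open>a(1)\<close> with it.
\<close>

no_notation fps_nth (infixl "$" 75)

section \<open>Definability\<close>

lemma definableI:
  assumes "wf_form M \<phi>" "\<And>s n. e s n \<in> univ M s" "X \<subseteq> tuples M ss"
    and "\<And>xs. xs \<in> tuples M ss \<Longrightarrow> xs \<in> X \<longleftrightarrow> sat M (assign ss xs e) \<phi>"
  shows "definable M ss X"
  unfolding definable_def using assms by (intro exI[of _ \<phi>] exI[of _ e]) blast

text \<open>Interpretations are given by decoding maps; here each element has one chosen code
  \<open>\<phi> s x\<close>, decoded by \<open>inv_into\<close>. Since codes are unique, the
  preimage of equality is the diagonal and the graph of an operation can be listed by its
  arguments.\<close>

lemma definable_inI: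
  fixes \<phi> :: "'t \<Rightarrow> 'b \<Rightarrow> 'a list"
  assumes inj: "\<And>s. inj_on (\<phi> s) (univ N s)"
    and dom: "\<And>s. definable M (idx s) (\<phi> s ` univ N s)"
    and diag: "\<And>s. definable M (idx s @ idx s) ((\<lambda>x. \<phi> s x @ \<phi> s x) ` univ N s)"
    and closed: "\<And>f xs. list_all2 (\<lambda>x s. x \<in> univ N s) xs (args N f)
                   \<Longrightarrow> interp N f xs \<in> univ N (res N f)"
    and graph: "\<And>f. definable M (concat (map idx (args N f)) @ idx (res N f))
                   {concat (map2 \<phi> (args N f) xs) @ \<phi> (res N f) (interp N f xs) | xs.
                      list_all2 (\<lambda>x s. x \<in> univ N s) xs (args N f)}"
  shows "definable_in N M"
proof -
  define D where "D = (\<lambda>s. \<phi> s ` univ N s)"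
  define \<pi> where "\<pi> = (\<lambda>s. inv_into (univ N s) (\<phi> s))"
  have \<pi>\<phi>: "\<pi> s (\<phi> s x) = x" if "x \<in> univ N s" for s x
    using that inj by (simp add: \<pi>_def)
  have \<phi>\<pi>: "\<phi> s (\<pi> s xs) = xs" "\<pi> s xs \<in> univ N s" if "xs \<in> D s" for s xs
    using that \<pi>\<phi> by (auto simp: D_def)
  have inj\<pi>: "inj_on (\<pi> s) (D s)" for s
    by (metis inj_onI \<phi>\<pi>(1))
  have im: "\<pi> s ` D s = univ N s" for s
    using \<pi>\<phi> by (force simp: D_def)
  have eq: "{xs @ ys | xs ys. xs \<in> D s \<and> ys \<in> D s \<and> \<pi> s xs = \<pi> s ys}
              = (\<lambda>x. \<phi> s x @ \<phi> s x) ` univ N s" for s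
    using \<pi>\<phi> by (auto simp: D_def)
  \<comment> \<open>Coding and decoding are mutually inverse on whole argument lists; this and
    \<open>decode\<close> give the two inclusions of \<open>gr\<close>.\<close>
  have code: "map2 \<phi> ss (map2 \<pi> ss xss) = xss \<and> list_all2 (\<lambda>x s. x \<in> univ N s) (map2 \<pi> ss xss) ss"
    if "list_all2 (\<lambda>xs s. xs \<in> D s) xss ss" for xss ss
    using that by (induction rule: list_all2_induct) (auto simp: \<phi>\<pi>)
  have decode: "map2 \<pi> ss (map2 \<phi> ss xs) = xs \<and> list_all2 (\<lambda>xs s. xs \<in> D s) (map2 \<phi> ss xs) ss"
    if "list_all2 (\<lambda>x s. x \<in> univ N s) xs ss" for xs ss
    using that by (induction rule: list_all2_induct) (auto simp: \<pi>\<phi> D_def)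
  have gr: "{concat xss @ ys | xss ys.
           list_all2 (\<lambda>xs s. xs \<in> D s) xss (args N f) \<and> ys \<in> D (res N f) \<and>
           \<pi> (res N f) ys = interp N f (map2 \<pi> (args N f) xss)}
       = {concat (map2 \<phi> (args N f) xs) @ \<phi> (res N f) (interp N f xs) | xs.
                      list_all2 (\<lambda>x s. x \<in> univ N s) xs (args N f)}" (is "?l = ?r") for f
  proof
    show "?l \<subseteq> ?r"
    proof
      fix zs assume "zs \<in> ?l"
      then obtain xss ys where h: "zs = concat xss @ ys" "list_all2 (\<lambda>xs s. xs \<in> D s) xss (args N f)"
        "ys \<in> D (res N f)" "\<pi> (res N f) ys = interp N f (map2 \<pi> (args N f) xss)"
        by blast
      have "ys = \<phi> (res N f) (interp N f (map2 \<pi> (args N f) xss))"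
        using h(3,4) \<phi>\<pi>(1) by metis
      then show "zs \<in> ?r"
        using h(1) code[OF h(2)] by (intro CollectI exI[of _ "map2 \<pi> (args N f) xss"]) simp
    qed
    show "?r \<subseteq> ?l"
    proof
      fix zs assume "zs \<in> ?r"
      then obtain xs where h: "zs = concat (map2 \<phi> (args N f) xs) @ \<phi> (res N f) (interp N f xs)"
        "list_all2 (\<lambda>x s. x \<in> univ N s) xs (args N f)"
        by blast
      show "zs \<in> ?l"
        using h(1) decode[OF h(2)] closed[OF h(2)] \<pi>\<phi>
        by (intro CollectI exI[of _ "map2 \<phi> (args N f) xs"] exI[of _ "\<phi> (res N f) (interp N f xs)"])
          (simp add: D_def)
    qed
  qed
  have "interpretation_in N M idx D \<pi>"
    unfolding interpretation_in_def eq gr im using dom diag graph by (simp add: D_def)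
  with inj\<pi> show ?thesis
    unfolding definable_in_def by blast
qed

text \<open>This and \<open>graph2\<close> unfold the graphs in \<open>definable_inI\<close> for
  unary and binary operations.\<close>

lemma graph1:
  "{concat (map2 \<phi> [p] xs) @ r xs | xs. list_all2 P xs [p]} = {\<phi> p x @ r [x] | x. P x p}"
  by (force simp: list_all2_Cons2)

lemma graph2:
  "{concat (map2 \<phi> [p, q] xs) @ r xs | xs. list_all2 P xs [p, q]}
     = {\<phi> p x @ \<phi> q y @ r [x, y] | x y. P x p \<and> P y q}"
  by (force simp: list_all2_Cons2)

definition Disj :: "('s, 'f) fo_form \<Rightarrow> ('s, 'f) fo_form \<Rightarrow> ('s, 'f) fo_form" where
  "Disj \<phi> \<psi> = Neg (Conj (Neg \<phi>) (Neg \<psi>))"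

lemma sat_Disj [simp]: "sat M e (Disj \<phi> \<psi>) \<longleftrightarrow> sat M e \<phi> \<or> sat M e \<psi>"
  and wf_Disj [simp]: "wf_form M (Disj \<phi> \<psi>) \<longleftrightarrow> wf_form M \<phi> \<and> wf_form M \<psi>"
  by (simp_all add: Disj_def)

section \<open>Two by two matrices\<close>

text \<open>A common shape for all matrices in play, so that matrix equations reduce by
  simplification to equations between entries.\<close>

definition mat2 :: "'k::field \<Rightarrow> 'k \<Rightarrow> 'k \<Rightarrow> 'k \<Rightarrow> 'k^2^2" where
  "mat2 a b c d = vector [vector [a, b], vector [c, d]]"

lemma mat2_nth [simp]:
  "mat2 a b c d $ 1 $ 1 = a" "mat2 a b c d $ 1 $ 2 = b"
  "mat2 a b c d $ 2 $ 1 = c" "mat2 a b c d $ 2 $ 2 = d"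
  by (simp_all add: mat2_def)

lemma mat2_eq_iff [simp]:
  "mat2 a b c d = mat2 a' b' c' d' \<longleftrightarrow> a = a' \<and> b = b' \<and> c = c' \<and> d = d'"
  by (metis mat2_nth)

lemma mat2_cases: obtains a b c d where "M = mat2 a b c d"
proof
  show "M = mat2 (M $ 1 $ 1) (M $ 1 $ 2) (M $ 2 $ 1) (M $ 2 $ 2)"
    by (simp add: vec_eq_iff forall_2)
qed

lemma mat2_mult [simp]:
  "mat2 a b c d ** mat2 a' b' c' d' =
     mat2 (a * a' + b * c') (a * b' + b * d') (c * a' + d * c') (c * b' + d * d')"
  by (simp add: vec_eq_iff forall_2 matrix_matrix_mult_def sum_2)

lemma det_mat2 [simp]: "det (mat2 a b c d) = a * d - b * c"
  by (simp add: det_2)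

lemma mat_1_mat2: "mat 1 = mat2 1 0 0 1"
  by (simp add: vec_eq_iff forall_2 mat_def)

lemma a_mat_mat2: "a_mat t = mat2 1 t 0 1"
  and b_mat_mat2: "b_mat t = mat2 1 0 t 1"
  and Diag_mat2: "Diag x y = mat2 x 0 0 y"
  by (simp_all add: a_mat_def b_mat_def Diag_def mat2_def)

lemma SL2_simps [simp]:
  "carrier SL2 = {M. det M = 1}" "mult SL2 = (**)" "one SL2 = mat 1"
  by (simp_all add: SL2_def)

lemma group_SL2: "group (SL2 :: ('k::field^2^2) monoid)"
proof (rule groupI)
  fix M :: "'k^2^2" assume M: "M \<in> carrier SL2"
  obtain a b c d where "M = mat2 a b c d" by (rule mat2_cases)
  with M show "\<exists>N\<in>carrier SL2. N \<otimes>\<^bsub>SL2\<^esub> M = \<one>\<^bsub>SL2\<^esub>"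
    by (intro bexI[of _ "mat2 d (-b) (-c) a"]) (auto simp: mat_1_mat2 algebra_simps)
qed (auto simp: det_mul matrix_mul_assoc)

lemma inv_SL2_mat2:
  assumes "a * d - b * c = (1::'k::field)"
  shows "inv\<^bsub>SL2\<^esub> (mat2 a b c d) = mat2 d (-b) (-c) a"
  using assms by (intro group.inv_equality[OF group_SL2]) (auto simp: mat_1_mat2 algebra_simps)

section \<open>The group $G$\<close>

locale subspace_char2 =
  fixes L :: "'k::field set" and T :: "('k^2^2) set"
  assumes imperfect: "imperfect_char2 TYPE('k)"
    and L_add: "is_add_subgroup L"
    and squares_L: "range (\<lambda>x::'k. x\<^sup>2) \<subseteq> L"
    and L_scale: "\<And>c x. c \<in> range (\<lambda>x::'k. x\<^sup>2) \<Longrightarrow> x \<in> L \<Longrightarrow> c * x \<in> L"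
    and T_subgroup: "subgroup T SL2"
    and T_sub_T: "T_sub L \<subseteq> T"
    and T_T_full: "T \<subseteq> T_full"
begin

section \<open>Characteristic 2 arithmetic and closure properties of \<open>L\<close>\<close>

lemma two_eq_0: "(2::'k) = 0"
  using of_nat_CHAR[where ?'a='k] imperfect by (metis imperfect_char2_def of_nat_numeral)

lemma add_self [simp]: "(x::'k) + x = 0"
  by (metis mult_2 mult_zero_left two_eq_0)

lemma uminus_eq [simp]: "- (x::'k) = x"
  by (simp add: minus_unique)

lemma diff_eq_add: "(x::'k) - y = x + y"
  by (metis diff_conv_add_uminus uminus_eq)

lemma add_eq_0_iff2: "(x::'k) + y = 0 \<longleftrightarrow> x = y"
  using diff_eq_add eq_iff_diff_eq_0 by metis

lemma square_inject [simp]: "(x::'k)\<^sup>2 = y\<^sup>2 \<longleftrightarrow> x = y"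
  by (simp add: power2_eq_iff)

lemma square_eq_1 [simp]: "(x::'k)\<^sup>2 = 1 \<longleftrightarrow> x = 1"
  using square_inject[of x 1] by simp

lemma mult_self_eq_1 [simp]: "(x::'k) * x = 1 \<longleftrightarrow> x = 1"
  using square_eq_1[of x] by (simp add: power2_eq_square)

lemma square_add: "((x::'k) + y)\<^sup>2 = x\<^sup>2 + y\<^sup>2"
  by (simp add: power2_sum two_eq_0)

lemma add_closed [simp, intro]: "x \<in> L \<Longrightarrow> y \<in> L \<Longrightarrow> x + y \<in> L"
  and zero_L [simp, intro]: "0 \<in> L"
  using L_add by (auto simp: is_add_subgroup_def)

lemma square_L [simp, intro]: "x\<^sup>2 \<in> L"
  using squares_L by auto

lemma square_mult_L [simp, intro]: "x \<in> L \<Longrightarrow> c\<^sup>2 * x \<in> L"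
  using L_scale by auto

lemma one_L [simp, intro]: "1 \<in> L"
  using square_L[of 1] by simp

lemma divide_square_L: "x * c\<^sup>2 \<in> L \<Longrightarrow> c \<noteq> 0 \<Longrightarrow> x \<in> L"
  using square_mult_L[of "x * c\<^sup>2" "inverse c"] by (simp add: field_simps)

section \<open>The diagonal entries of \<open>T\<close> and the set \<open>T_bar\<close>\<close>

definition S :: "'k set" where
  "S = {s. Diag s (inverse s) \<in> T}"

lemma zero_notin_S [simp]: "0 \<notin> S"
  using subgroup.subset[OF T_subgroup] by (auto simp: S_def Diag_mat2)

lemma one_S [simp, intro]: "1 \<in> S"
  using subgroup.one_closed[OF T_subgroup] by (simp add: S_def Diag_mat2 mat_1_mat2)

lemma mult_S [intro]: "s \<in> S \<Longrightarrow> t \<in> S \<Longrightarrow> s * t \<in> S"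
  using subgroup.m_closed[OF T_subgroup, of "Diag s (inverse s)" "Diag t (inverse t)"]
  by (simp add: S_def Diag_mat2)

lemma inverse_S: assumes "s \<in> S" shows "inverse s \<in> S"
proof -
  have "s \<noteq> 0" using assms by auto
  then show ?thesis
    using subgroup.m_inv_closed[OF T_subgroup, of "Diag s (inverse s)"] assms
    by (simp add: S_def Diag_mat2 inv_SL2_mat2)
qed

lemma L_S: "x \<in> L \<Longrightarrow> x \<noteq> 0 \<Longrightarrow> x \<in> S"
  using T_sub_T generate.incl[of x "L - {0}" mult_group] by (auto simp: S_def T_sub_def)

lemma T_iff: "M \<in> T \<longleftrightarrow> (\<exists>s\<in>S. M = mat2 s 0 0 (inverse s))"
proof -
  have "\<exists>s\<in>S. M = mat2 s 0 0 (inverse s)" if "M \<in> T" for M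
  proof -
    obtain x y where "M = mat2 x 0 0 y" "x * y = 1"
      using \<open>M \<in> T\<close> T_T_full by (auto simp: T_full_def Diag_mat2)
    moreover have "y = inverse x"
      using \<open>x * y = 1\<close> by (metis inverse_unique)
    ultimately show ?thesis
      using \<open>M \<in> T\<close> by (auto simp: S_def Diag_mat2)
  qed
  then show ?thesis
    by (auto simp: S_def Diag_mat2)
qed

text \<open>Conjugation by \<open>Diag s (inverse s)\<close> multiplies the upper right entry by the
  square of \<open>s\<close>. Evaluating at \<open>1\<close>, which lies in \<open>L\<close>, shows
  that no other scalar arises.\<close>

lemma T_bar_eq: "T_bar L T = (\<lambda>s. s\<^sup>2) ` S"
proof -
  have conj: "h \<otimes>\<^bsub>SL2\<^esub> a_mat x \<otimes>\<^bsub>SL2\<^esub> inv\<^bsub>SL2\<^esub> h = a_mat (s\<^sup>2 * x)"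
    if "s \<in> S" "h = mat2 s 0 0 (inverse s)" for s h x
  proof -
    have "s \<noteq> 0" using that by auto
    then show ?thesis
      by (simp add: that inv_SL2_mat2 a_mat_mat2 power2_eq_square)
  qed
  show ?thesis
  proof (intro Set.set_eqI iffI)
    fix c assume "c \<in> T_bar L T"
    then obtain s where "s \<in> S" "\<forall>x\<in>L. a_mat (s\<^sup>2 * x) = a_mat (c * x)"
      using conj by (auto simp: T_bar_def T_iff)
    then show "c \<in> (\<lambda>s. s\<^sup>2) ` S"
      by (auto simp: a_mat_mat2 dest: bspec[of _ _ 1])
  next
    fix c assume "c \<in> (\<lambda>s. s\<^sup>2) ` S"
    then obtain s where "s \<in> S" "c = s\<^sup>2" by blast
    then show "c \<in> T_bar L T"
      using conj[of s] by (auto simp: T_bar_def T_iff intro!: bexI[of _ "mat2 s 0 0 (inverse s)"])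
  qed
qed

definition S0 :: "'k set" where
  "S0 = insert 0 S"

lemma S0_simps [simp, intro]: "0 \<in> S0" "1 \<in> S0"
  and S_S0: "s \<in> S \<Longrightarrow> s \<in> S0"
  and L_S0: "x \<in> L \<Longrightarrow> x \<in> S0"
  and mult_S0: "s \<in> S0 \<Longrightarrow> t \<in> S0 \<Longrightarrow> s * t \<in> S0"
  using L_S by (auto simp: S0_def)

lemma S0_nonzero: "s \<in> S0 \<Longrightarrow> s \<noteq> 0 \<Longrightarrow> s \<in> S"
  by (simp add: S0_def)

text \<open>The set \<open>S0\<close> need not be closed under addition. If \<open>b\<close> and
  \<open>a'\<close> are nonzero, dividing the sum by \<open>b * a'\<close> gives
  \<open>a / b + c' / a'\<close>, which is \<open>a * b\<close> plus \<open>a' * c'\<close> scaled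
  by squares and hence lies in \<open>L\<close>.\<close>

lemma dot_S0:
  assumes "a \<in> S0" "b \<in> S0" "a' \<in> S0" "c' \<in> S0" "a * b \<in> L" "a' * c' \<in> L"
  shows "a * a' + b * c' \<in> S0"
proof (cases "b = 0 \<or> a' = 0")
  case True
  then show ?thesis using assms by (auto intro: mult_S0)
next
  case False
  have "(inverse b)\<^sup>2 * (a * b) + (inverse a')\<^sup>2 * (a' * c') \<in> S0"
    using assms by (intro L_S0) auto
  then have "b * a' * ((inverse b)\<^sup>2 * (a * b) + (inverse a')\<^sup>2 * (a' * c')) \<in> S0"
    using assms by (intro mult_S0)
  also have "b * a' * ((inverse b)\<^sup>2 * (a * b) + (inverse a')\<^sup>2 * (a' * c')) = a * a' + b * c'"
    using False by (simp add: field_simps power2_eq_square)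
  finally show ?thesis .
qed

section \<open>\<open>G\<close> as an explicit group of matrices\<close>

definition in_G :: "'k \<Rightarrow> 'k \<Rightarrow> 'k \<Rightarrow> 'k \<Rightarrow> bool" where
  "in_G a b c d \<longleftrightarrow> a * d + b * c = 1 \<and> {a, b, c, d} \<subseteq> S0 \<and> {a * b, c * d, a * c, b * d} \<subseteq> L"

definition G :: "('k^2^2) set" where
  "G = {mat2 a b c d | a b c d. in_G a b c d}"

lemma mat2_in_G [simp]: "mat2 a b c d \<in> G \<longleftrightarrow> in_G a b c d"
  by (auto simp: G_def)

lemma bex_G: "(\<exists>M\<in>G. P M) \<longleftrightarrow> (\<exists>a b c d. in_G a b c d \<and> P (mat2 a b c d))"
  unfolding G_def by blast

text \<open>A product of two entries in one row or column of the matrix product expands into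
  elements of \<open>L\<close> scaled by squares, plus a mixed term whose extra factor is a
  determinant, that is, \<open>1\<close>. The entries themselves are handled by
  \<open>dot_S0\<close>.\<close>

lemma in_G_mult:
  assumes g: "in_G a b c d" and g': "in_G a' b' c' d'"
  shows "in_G (a * a' + b * c') (a * b' + b * d') (c * a' + d * c') (c * b' + d * d')"
proof -
  have det: "a * d + b * c = 1" "a' * d' + b' * c' = 1"
    using g g' by (auto simp: in_G_def)
  have row: "(p * a' + q * c') * (p * b' + q * d') \<in> L" if "p * q \<in> L" for p q
  proof -
    have "(p * a' + q * c') * (p * b' + q * d')
        = p\<^sup>2 * (a' * b') + q\<^sup>2 * (c' * d') + p * q * (a' * d' + b' * c')"
      by (simp add: algebra_simps power2_eq_square)
    also have "\<dots> \<in> L"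
      using that g' by (simp add: det in_G_def)
    finally show ?thesis .
  qed
  have col: "(a * p + b * q) * (c * p + d * q) \<in> L" if "p * q \<in> L" for p q
  proof -
    have "(a * p + b * q) * (c * p + d * q)
        = p\<^sup>2 * (a * c) + q\<^sup>2 * (b * d) + p * q * (a * d + b * c)"
      by (simp add: algebra_simps power2_eq_square)
    also have "\<dots> \<in> L"
      using that g by (simp add: det in_G_def)
    finally show ?thesis .
  qed
  \<comment> \<open>The last two brackets have the form \<open>z + z\<close> and vanish in
    characteristic 2.\<close>
  have "(a * a' + b * c') * (c * b' + d * d') + (a * b' + b * d') * (c * a' + d * c')
     = (a * d + b * c) * (a' * d' + b' * c') + (a * c * a' * b' + a * c * a' * b')
        + (b * d * c' * d' + b * d * c' * d')"
    by (simp add: algebra_simps del: add_self)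
  also have "\<dots> = 1"
    by (simp add: det)
  finally show ?thesis
    unfolding in_G_def using g g' row col
    by (auto simp: in_G_def mult.commute[of "c'" "d'"] intro!: dot_S0)
qed

lemma in_G_a: "in_G 1 t 0 1 \<longleftrightarrow> t \<in> L"
  and in_G_b: "in_G 1 0 t 1 \<longleftrightarrow> t \<in> L"
  by (auto simp: in_G_def L_S0)

lemma in_G_diag: "s \<in> S \<Longrightarrow> in_G s 0 0 (inverse s)"
  by (auto simp: in_G_def S_S0 inverse_S) (metis right_inverse zero_notin_S)

lemma subgroup_G: "subgroup G SL2"
proof (rule group.subgroupI[OF group_SL2])
  show "G \<subseteq> carrier SL2"
    by (auto simp: G_def in_G_def diff_eq_add)
  have "mat 1 \<in> G"
    by (simp add: mat_1_mat2 in_G_a)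
  then show "G \<noteq> {}" by blast
next
  fix M assume "M \<in> G"
  then obtain a b c d where M: "M = mat2 a b c d" "in_G a b c d" by (auto simp: G_def)
  then have "inv\<^bsub>SL2\<^esub> M = mat2 d b c a"
    by (simp add: inv_SL2_mat2 in_G_def diff_eq_add)
  then show "inv\<^bsub>SL2\<^esub> M \<in> G"
    using M by (auto simp: in_G_def algebra_simps)
next
  fix M N assume "M \<in> G" "N \<in> G"
  then show "M \<otimes>\<^bsub>SL2\<^esub> N \<in> G"
    by (auto simp: G_def in_G_mult)
qed

text \<open>One inclusion holds because \<open>T\<close> and the generators lie in the subgroup
  \<open>G\<close>. The other is the Bruhat decomposition, split by whether the lower left entry
  vanishes; the unipotent parameters lie in \<open>L\<close> because \<open>b / a\<close> and
  \<open>d / c\<close> are \<open>a * b\<close> and \<open>c * d\<close> divided by squares.\<close>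

lemma carrier_G_group: "carrier (G_group L T) = G"
proof -
  have gen: "a_mat ` L \<union> b_mat ` L \<subseteq> G"
    by (auto simp: a_mat_mat2 b_mat_mat2 in_G_a in_G_b)
  have "SL2_sub L \<subseteq> G"
    unfolding SL2_sub_def using group.generate_subgroup_incl[OF group_SL2 gen subgroup_G] .
  moreover have "T \<subseteq> G"
    by (auto simp: T_iff in_G_diag)
  ultimately have "T <#>\<^bsub>SL2\<^esub> SL2_sub L \<subseteq> G"
    using subgroup.m_closed[OF subgroup_G] by (auto simp: set_mult_def)
  moreover have "G \<subseteq> T <#>\<^bsub>SL2\<^esub> SL2_sub L"
  proof
    fix M assume "M \<in> G"
    then obtain a b c d where M: "M = mat2 a b c d" "in_G a b c d" by (auto simp: G_def)
    have a: "mat2 1 t 0 1 \<in> SL2_sub L" and b: "mat2 1 0 t 1 \<in> SL2_sub L" if "t \<in> L" for t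
      using that unfolding SL2_sub_def a_mat_mat2[symmetric] b_mat_mat2[symmetric]
      by (auto intro: generate.incl)
    have mult: "M ** N \<in> SL2_sub L" if "M \<in> SL2_sub L" "N \<in> SL2_sub L" for M N
      using generate.eng[of M SL2 _ N] that by (auto simp: SL2_sub_def)
    have "\<exists>h\<in>T. \<exists>k\<in>SL2_sub L. M = h ** k"
    proof (cases "c = 0")
      case True
      then have ad: "a * d = 1" "a \<in> S0" "a * b \<in> L"
        using M by (auto simp: in_G_def)
      then have "a \<noteq> 0" by auto
      then have "b / a \<in> L"
        using ad divide_square_L[of "b / a" a] by (simp add: power2_eq_square mult.commute)
      moreover have "d = inverse a"
        using ad by (metis inverse_unique)
      ultimately show ?thesis
        using True M \<open>a \<noteq> 0\<close> ad
        by (intro bexI[of _ "mat2 a 0 0 (inverse a)"] bexI[of _ "mat2 1 (b / a) 0 1"])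
          (auto simp: T_iff a S0_nonzero)
    next
      case False
      have *: "a * d + b * c = 1" "c \<in> S" "a * c \<in> L" "c * d \<in> L"
        using M False by (auto simp: in_G_def S0_nonzero)
      have "d / c \<in> L"
        using * False divide_square_L[of "d / c" c] by (simp add: power2_eq_square mult.commute)
      \<comment> \<open>This is \<open>a(a * c)\<close>, the Weyl element
        \<open>a(1) b(1) a(1)\<close> and \<open>a(d / c)\<close> multiplied together; merging
        adjacent upper unipotents produces the two summands \<open>1\<close>.\<close>
      then have "mat2 1 (a * c + 1) 0 1 ** mat2 1 0 1 1 ** mat2 1 (d / c + 1) 0 1 \<in> SL2_sub L"
        using * by (intro mult a b) auto
      moreover have "mat2 (inverse c) 0 0 c \<in> T"
        using inverse_S[OF \<open>c \<in> S\<close>] by (auto simp: T_iff image_iff intro!: bexI[of _ "inverse c"])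
      moreover have "b = inverse c * (a * d + 1)"
      proof -
        have "a * d + 1 = b * c"
          by (metis *(1) add_eq_0_iff2 add.assoc add.commute add_self)
        then show ?thesis using False by simp
      qed
      then have "M = mat2 (inverse c) 0 0 c **
                   (mat2 1 (a * c + 1) 0 1 ** mat2 1 0 1 1 ** mat2 1 (d / c + 1) 0 1)"
        using False by (simp add: M add.assoc[symmetric]) (simp add: field_simps two_eq_0)
      ultimately show ?thesis by blast
    qed
    then show "M \<in> T <#>\<^bsub>SL2\<^esub> SL2_sub L"
      by (auto simp: set_mult_def)
  qed
  ultimately show ?thesis
    by (auto simp: G_group_def)
qed

end

lemma replicate_4: "replicate 4 x = [x, x, x, x]"
  and replicate_12: "replicate 12 x = [x, x, x, x, x, x, x, x, x, x, x, x]"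
  by (simp_all add: numeral_eq_Suc)

section \<open>Defining $G$ in the structure on $(L, \bar T)$\<close>

lemma LT_simps [simp]:
  "univ (LT_struct L Tb) s = (case s of SortL \<Rightarrow> L | SortT \<Rightarrow> Tb)"
  "args (LT_struct L Tb) f = (case f of Add \<Rightarrow> [SortL, SortL] | Act \<Rightarrow> [SortT, SortL] | Sq \<Rightarrow> [SortL])"
  "res (LT_struct L Tb) f = SortL"
  "interp (LT_struct L Tb) f xs =
     (case f of Add \<Rightarrow> xs ! 0 + xs ! 1 | Act \<Rightarrow> xs ! 0 * xs ! 1 | Sq \<Rightarrow> (xs ! 0)\<^sup>2)"
  by (simp_all add: LT_struct_def)

section \<open>Formulas for entries, products and matrices coded by squares\<close>

abbreviation vL :: "nat \<Rightarrow> (lt_sort, lt_op) fo_term" where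
  "vL \<equiv> Var SortL"

abbreviation vT :: "nat \<Rightarrow> (lt_sort, lt_op) fo_term" where
  "vT \<equiv> Var SortT"

abbreviation is_zeroF :: "nat \<Rightarrow> (lt_sort, lt_op) fo_form" where
  "is_zeroF i \<equiv> Eq (App Add [vL i, vL i]) (vL i)"

text \<open>Variables from 30 on are bound; \<open>vL 20\<close> is a parameter that stands for \<open>1\<close>.\<close>

definition in_T0F :: "nat \<Rightarrow> (lt_sort, lt_op) fo_form" where
  "in_T0F i = Disj (is_zeroF i) (Ex SortT 30 (Eq (App Act [vT 30, vL 20]) (vL i)))"

text \<open>
  For nonzero \<open>x\<close> in \<open>L\<close> the square of \<open>x\<close> lies in \<open>\<bar>T\<close>, and \<open>x y = z\<close> is equivalent to
  \<open>x\<^sup>2 \<cdot> y\<^sup>2 = z\<^sup>2\<close>, where the product is the action of \<open>\<bar>T\<close> on \<open>L\<close>.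
\<close>

definition multF :: "nat \<Rightarrow> nat \<Rightarrow> nat \<Rightarrow> (lt_sort, lt_op) fo_form" where
  "multF i j k = Disj (Conj (is_zeroF i) (is_zeroF k))
     (Ex SortT 30 (Conj (Eq (App Act [vT 30, vL 20]) (App Sq [vL i]))
                        (Eq (App Act [vT 30, App Sq [vL j]]) (App Sq [vL k]))))"

text \<open>The variables hold squares of entries, so the product of the entries lies in
  \<open>L\<close> iff the product of the variables is the square of an element of
  \<open>L\<close>.\<close>

definition prod_in_L_F :: "nat \<Rightarrow> nat \<Rightarrow> (lt_sort, lt_op) fo_form" where
  "prod_in_L_F i j = Ex SortL 31 (Ex SortL 32 (Conj (Eq (vL 32) (App Sq [vL 31])) (multF i j 32)))"

definition dotF :: "nat \<Rightarrow> nat \<Rightarrow> nat \<Rightarrow> nat \<Rightarrow> nat \<Rightarrow> (lt_sort, lt_op) fo_form" where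
  "dotF i j k l m = Ex SortL 31 (Ex SortL 32
     (Conj (Conj (multF i j 31) (multF k l 32)) (Eq (App Add [vL 31, vL 32]) (vL m))))"

text \<open>The offset \<open>i\<close> lets the formula be used for either factor of a product. The
  determinant condition is a \<open>dotF\<close> whose target is the parameter
  \<open>1\<close>.\<close>

definition in_GF :: "nat \<Rightarrow> (lt_sort, lt_op) fo_form" where
  "in_GF i = Conj (Conj (Conj (in_T0F i) (in_T0F (i + 1))) (Conj (in_T0F (i + 2)) (in_T0F (i + 3))))
     (Conj (dotF i (i + 3) (i + 1) (i + 2) 20)
       (Conj (Conj (prod_in_L_F i (i + 1)) (prod_in_L_F (i + 2) (i + 3)))
             (Conj (prod_in_L_F i (i + 2)) (prod_in_L_F (i + 1) (i + 3)))))"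

definition matmulF :: "(lt_sort, lt_op) fo_form" where
  "matmulF = Conj (Conj (dotF 0 4 1 6 8) (dotF 0 5 1 7 9)) (Conj (dotF 2 4 3 6 10) (dotF 2 5 3 7 11))"

lemma wf_LT [simp]:
  "wf_form (LT_struct L Tb) (in_T0F i)"
  "wf_form (LT_struct L Tb) (multF i j k)"
  "wf_form (LT_struct L Tb) (prod_in_L_F i j)"
  "wf_form (LT_struct L Tb) (dotF i j k l m)"
  "wf_form (LT_struct L Tb) (in_GF i)"
  "wf_form (LT_struct L Tb) matmulF"
  by (simp_all add: in_T0F_def multF_def prod_in_L_F_def dotF_def in_GF_def matmulF_def)

context subspace_char2
begin

abbreviation LT :: "(lt_sort, lt_op, 'k) fo_struct" where
  "LT \<equiv> LT_struct L (T_bar L T)"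

lemma square_S0_iff: "x\<^sup>2 \<in> (\<lambda>s. s\<^sup>2) ` S0 \<longleftrightarrow> x \<in> S0"
  by auto

text \<open>Acting on \<open>1\<close> embeds \<open>T_bar L T\<close>, the set of squares of
  \<open>S\<close>, into \<open>L\<close>.\<close>

lemma sat_in_T0F [simp]:
  assumes "e SortL 20 = 1"
  shows "sat LT e (in_T0F i) \<longleftrightarrow> e SortL i \<in> (\<lambda>s. s\<^sup>2) ` S0"
  using assms by (auto simp: in_T0F_def T_bar_eq S0_def)

text \<open>The only candidate for the bound variable is the square of the first factor. It belongs
  to \<open>T_bar L T\<close> exactly when that factor, an element of \<open>L\<close>, is
  nonzero.\<close>

lemma sat_multF [simp]:
  assumes "e SortL 20 = 1" "e SortL i \<in> L"
  shows "sat LT e (multF i j k) \<longleftrightarrow> e SortL i * e SortL j = e SortL k"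
proof (cases "e SortL i = 0")
  case True
  then show ?thesis
    using assms by (auto simp: multF_def T_bar_eq)
next
  case False
  then have "e SortL i \<in> S"
    using assms by (simp add: L_S)
  then show ?thesis
    using assms False
    by (auto simp: multF_def T_bar_eq image_iff simp flip: power_mult_distrib)
qed

lemma sat_prod_in_L_F [simp]:
  assumes "e SortL 20 = 1" "e SortL i = a\<^sup>2" "e SortL j = b\<^sup>2" "i < 20" "j < 20"
  shows "sat LT e (prod_in_L_F i j) \<longleftrightarrow> a * b \<in> L"
  using assms by (auto simp: prod_in_L_F_def simp flip: power_mult_distrib)

text \<open>Squaring is additive, so sums of products of squares are squares of sums of products.
  The bound on \<open>m\<close> includes \<open>20\<close> so that the target may be the parameter
  \<open>1\<close>.\<close>

lemma sat_dotF [simp]: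
  assumes "e SortL 20 = 1" "e SortL i = a\<^sup>2" "e SortL j = b\<^sup>2" "e SortL k = c\<^sup>2" "e SortL l = d\<^sup>2"
    and "i < 20" "j < 20" "k < 20" "l < 20" "m \<le> 20"
  shows "sat LT e (dotF i j k l m) \<longleftrightarrow> e SortL m = (a * b + c * d)\<^sup>2"
  using assms by (auto simp: dotF_def square_add power_mult_distrib)

lemma sat_in_GF:
  assumes "e SortL 20 = 1" "i < 17"
  shows "sat LT e (in_GF i) \<longleftrightarrow> (\<exists>a b c d. in_G a b c d \<and>
     e SortL i = a\<^sup>2 \<and> e SortL (i + 1) = b\<^sup>2 \<and> e SortL (i + 2) = c\<^sup>2 \<and> e SortL (i + 3) = d\<^sup>2)"
    (is "_ \<longleftrightarrow> ?R")
proof -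
  have *: "sat LT e (in_GF i) \<longleftrightarrow> in_G a b c d"
    if "e SortL i = a\<^sup>2" "e SortL (i + 1) = b\<^sup>2" "e SortL (i + 2) = c\<^sup>2" "e SortL (i + 3) = d\<^sup>2"
    for a b c d
    using assms that by (auto simp: in_GF_def in_G_def square_S0_iff eq_commute[of 1])
  show ?thesis
  proof
    assume h: "sat LT e (in_GF i)"
    \<comment> \<open>The four conjuncts \<open>in_T0F\<close> already force the values to be
      squares.\<close>
    then obtain a b c d where
      "e SortL i = a\<^sup>2" "e SortL (i + 1) = b\<^sup>2" "e SortL (i + 2) = c\<^sup>2" "e SortL (i + 3) = d\<^sup>2"
      using assms by (auto simp: in_GF_def)
    then show ?R using * h by blast
  qed (use * in blast)
qed

section \<open>Coding \<open>G\<close> by squared entries\<close>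

definition square_entries :: "'k^2^2 \<Rightarrow> 'k list" where
  "square_entries M = [(M $ 1 $ 1)\<^sup>2, (M $ 1 $ 2)\<^sup>2, (M $ 2 $ 1)\<^sup>2, (M $ 2 $ 2)\<^sup>2]"

lemma square_entries_mat2 [simp]: "square_entries (mat2 a b c d) = [a\<^sup>2, b\<^sup>2, c\<^sup>2, d\<^sup>2]"
  by (simp add: square_entries_def)

text \<open>Makes the constant assignment \<open>1\<close> legitimate in both sorts.\<close>

lemma one_T_bar: "1 \<in> T_bar L T"
  using one_S by (force simp: T_bar_eq)

lemma univ_G [simp]: "univ (group_struct (G_group L T)) s = G"
  and args_G [simp]: "args (group_struct (G_group L T)) f = [(), ()]"
  and interp_G [simp]: "interp (group_struct (G_group L T)) f xs = xs ! 0 ** xs ! 1"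
  by (simp_all add: group_struct_def carrier_G_group) (simp add: G_group_def)

lemma G_definable_in_LT: "definable_in (group_struct (G_group L T)) LT"
proof (rule definable_inI[where idx = "\<lambda>_. replicate 4 SortL" and \<phi> = "\<lambda>_. square_entries"])
  fix s :: unit
  show "inj_on square_entries (univ (group_struct (G_group L T)) s)"
    by (auto simp: inj_on_def G_def)
  have par: "1 \<in> univ LT s" for s
    using one_T_bar by (cases s) auto
  show "definable LT (replicate 4 SortL) (square_entries ` univ (group_struct (G_group L T)) s)"
  proof (rule definableI[where \<phi> = "in_GF 0" and e = "\<lambda>_ _. 1"])
    fix xs assume "xs \<in> tuples LT (replicate 4 SortL)"
    then obtain A B C D where "xs = [A, B, C, D]"
      by (auto simp: tuples_def replicate_4 replicate_12 list_all2_Cons2)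
    then show "xs \<in> square_entries ` univ (group_struct (G_group L T)) s
        \<longleftrightarrow> sat LT (assign (replicate 4 SortL) xs (\<lambda>_ _. 1)) (in_GF 0)"
      by (simp add: sat_in_GF assign_def) (force simp: G_def image_iff)
  qed (use par in \<open>auto simp: G_def tuples_def replicate_4 replicate_12\<close>)
  show "definable LT (replicate 4 SortL @ replicate 4 SortL)
      ((\<lambda>x. square_entries x @ square_entries x) ` univ (group_struct (G_group L T)) s)"
  proof (rule definableI[where e = "\<lambda>_ _. 1" and \<phi> = "Conj (in_GF 0)
      (Conj (Conj (Eq (vL 0) (vL 4)) (Eq (vL 1) (vL 5))) (Conj (Eq (vL 2) (vL 6)) (Eq (vL 3) (vL 7))))"])
    fix xs assume "xs \<in> tuples LT (replicate 4 SortL @ replicate 4 SortL)"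
    then obtain A B C D A' B' C' D' where "xs = [A, B, C, D, A', B', C', D']"
      by (auto simp: tuples_def replicate_4 replicate_12 list_all2_Cons2)
    then show "xs \<in> (\<lambda>x. square_entries x @ square_entries x) ` univ (group_struct (G_group L T)) s
        \<longleftrightarrow> sat LT (assign (replicate 4 SortL @ replicate 4 SortL) xs (\<lambda>_ _. 1)) (Conj (in_GF 0)
      (Conj (Conj (Eq (vL 0) (vL 4)) (Eq (vL 1) (vL 5))) (Conj (Eq (vL 2) (vL 6)) (Eq (vL 3) (vL 7)))))"
      by (simp add: sat_in_GF assign_def nth_append) (force simp: G_def image_iff)
  qed (use par in \<open>auto simp: G_def tuples_def replicate_4 replicate_12\<close>)
next
  fix f and xs :: "('k^2^2) list"
  assume "list_all2 (\<lambda>x s. x \<in> univ (group_struct (G_group L T)) s) xs (args (group_struct (G_group L T)) f)"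
  then show "interp (group_struct (G_group L T)) f xs
      \<in> univ (group_struct (G_group L T)) (res (group_struct (G_group L T)) f)"
    using subgroup.m_closed[OF subgroup_G] by (auto simp: list_all2_Cons2)
next
  fix f
  let ?ss = "replicate 12 SortL"
  \<comment> \<open>Variables 0-3 and 4-7 hold the factors; \<open>matmulF\<close> then determines
    8-11.\<close>
  let ?\<phi> = "Conj (Conj (in_GF 0) (in_GF 4)) matmulF"
  have "definable LT ?ss
      {square_entries M @ square_entries N @ square_entries (M ** N) | M N. M \<in> G \<and> N \<in> G}"
    (is "definable _ _ ?X")
  proof (rule definableI[where e = "\<lambda>_ _. 1" and \<phi> = ?\<phi>])
    show "?X \<subseteq> tuples LT ?ss"
      by (auto simp: G_def tuples_def replicate_4 replicate_12)
    fix xs assume "xs \<in> tuples LT ?ss"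
    then obtain A B C D A' B' C' D' A'' B'' C'' D''
      where xs: "xs = [A, B, C, D, A', B', C', D', A'', B'', C'', D'']"
      by (auto simp: tuples_def replicate_4 replicate_12 list_all2_Cons2)
    define e where "e = assign ?ss xs (\<lambda>_ _. 1)"
    have e: "e SortL 0 = A" "e SortL 1 = B" "e SortL 2 = C" "e SortL 3 = D"
      "e SortL 4 = A'" "e SortL 5 = B'" "e SortL 6 = C'" "e SortL 7 = D'"
      "e SortL 8 = A''" "e SortL 9 = B''" "e SortL 10 = C''" "e SortL 11 = D''" "e SortL 20 = 1"
      "e SortL (Suc 0) = B" "e SortL (Suc (Suc 0)) = C"
      by (simp_all add: e_def assign_def xs)
    have mul: "sat LT e matmulF \<longleftrightarrow> A'' = (a * a' + b * c')\<^sup>2 \<and> B'' = (a * b' + b * d')\<^sup>2 \<and>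
        C'' = (c * a' + d * c')\<^sup>2 \<and> D'' = (c * b' + d * d')\<^sup>2"
      if "A = a\<^sup>2" "B = b\<^sup>2" "C = c\<^sup>2" "D = d\<^sup>2" "A' = a'\<^sup>2" "B' = b'\<^sup>2" "C' = c'\<^sup>2" "D' = d'\<^sup>2"
      for a b c d a' b' c' d'
      using that e by (simp add: matmulF_def)
    have "sat LT e ?\<phi> \<longleftrightarrow> (\<exists>a b c d a' b' c' d'. in_G a b c d \<and> in_G a' b' c' d' \<and>
        A = a\<^sup>2 \<and> B = b\<^sup>2 \<and> C = c\<^sup>2 \<and> D = d\<^sup>2 \<and> A' = a'\<^sup>2 \<and> B' = b'\<^sup>2 \<and> C' = c'\<^sup>2 \<and> D' = d'\<^sup>2 \<and>
        A'' = (a * a' + b * c')\<^sup>2 \<and> B'' = (a * b' + b * d')\<^sup>2 \<and>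
        C'' = (c * a' + d * c')\<^sup>2 \<and> D'' = (c * b' + d * d')\<^sup>2)"
      using mul by (simp add: sat_in_GF e) blast
    also have "\<dots> \<longleftrightarrow> xs \<in> ?X"
    proof -
      have "xs \<in> ?X \<longleftrightarrow> (\<exists>M\<in>G. \<exists>N\<in>G. xs = square_entries M @ square_entries N @ square_entries (M ** N))"
        by blast
      then show ?thesis
        by (simp add: bex_G xs)
    qed
    finally show "xs \<in> ?X \<longleftrightarrow> sat LT (assign ?ss xs (\<lambda>_ _. 1)) ?\<phi>"
      by (simp add: e_def)
  qed (use one_T_bar in \<open>auto split: lt_sort.split\<close>)
  moreover have "replicate 4 SortL @ replicate 4 SortL @ replicate 4 SortL = ?ss"
    by (simp flip: replicate_add)
  ultimately show "definable LT (concat (map (\<lambda>_. replicate 4 SortL) (args (group_struct (G_group L T)) f))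
          @ replicate 4 SortL)
        {concat (map2 (\<lambda>_. square_entries) (args (group_struct (G_group L T)) f) xs)
           @ square_entries (interp (group_struct (G_group L T)) f xs) | xs.
         list_all2 (\<lambda>x s. x \<in> univ (group_struct (G_group L T)) s) xs
           (args (group_struct (G_group L T)) f)}"
    by (simp only: args_G graph2) simp
qed

end

section \<open>Defining the structure on $(L, \bar T)$ in $G$\<close>

abbreviation gmul :: "(unit, grp_op) fo_term \<Rightarrow> (unit, grp_op) fo_term \<Rightarrow> (unit, grp_op) fo_term"
    (infixl "\<star>" 70) where
  "t \<star> u \<equiv> App Mult [t, u]"

abbreviation vG :: "nat \<Rightarrow> (unit, grp_op) fo_term" where
  "vG \<equiv> Var ()"

abbreviation commF :: "nat \<Rightarrow> nat \<Rightarrow> (unit, grp_op) fo_form" where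
  "commF i j \<equiv> Eq (vG i \<star> vG j) (vG j \<star> vG i)"

context subspace_char2
begin

section \<open>Parameters and centralizers in \<open>G\<close>\<close>

lemma ex_S_ne_1: "\<exists>s\<in>S. s \<noteq> 1"
proof -
  \<comment> \<open>A non-square differs from \<open>0\<close> and \<open>1\<close>; its square lies
    in \<open>L\<close>, hence in \<open>S\<close>, and is again different from
    \<open>1\<close>.\<close>
  obtain z :: 'k where "z \<notin> range (\<lambda>x. x\<^sup>2)"
    using imperfect by (auto simp: imperfect_char2_def)
  then have "z \<noteq> 0" "z \<noteq> 1"
    by (metis power_zero_numeral rangeI, metis one_power2 rangeI)
  then show ?thesis
    by (intro bexI[of _ "z\<^sup>2"] L_S) auto
qed

definition h0 :: 'k where
  "h0 = (SOME s. s \<in> S \<and> s \<noteq> 1)"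

lemma h0: "h0 \<in> S" "h0 \<noteq> 1"
  using someI_ex[of "\<lambda>s. s \<in> S \<and> s \<noteq> 1"] ex_S_ne_1 by (auto simp: h0_def)

text \<open>Commuting with \<open>a(1)\<close> forces \<open>c = 0\<close> and \<open>a = d\<close>.
  Then the determinant is the square of \<open>a\<close>, so \<open>a = 1\<close>, and the row
  condition puts \<open>b\<close> into \<open>L\<close>.\<close>

lemma commute_a_iff:
  assumes "M \<in> G"
  shows "M ** mat2 1 1 0 1 = mat2 1 1 0 1 ** M \<longleftrightarrow> (\<exists>x\<in>L. M = mat2 1 x 0 1)"
proof -
  obtain a b c d where M: "M = mat2 a b c d" "in_G a b c d"
    using assms by (auto simp: G_def)
  show ?thesis
    using M(2) by (auto simp: M(1) in_G_def add.commute)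
qed

lemma commute_b_iff:
  assumes "M \<in> G"
  shows "M ** mat2 1 0 1 1 = mat2 1 0 1 1 ** M \<longleftrightarrow> (\<exists>x\<in>L. M = mat2 1 0 x 1)"
proof -
  obtain a b c d where M: "M = mat2 a b c d" "in_G a b c d"
    using assms by (auto simp: G_def)
  show ?thesis
    using M(2) by (auto simp: M(1) in_G_def add.commute)
qed

text \<open>In characteristic 2, \<open>h0\<close> differs from its inverse because it is not
  \<open>1\<close>, so commuting kills both off-diagonal entries.\<close>

lemma commute_h_iff:
  assumes "M \<in> G"
  shows "M ** mat2 h0 0 0 (inverse h0) = mat2 h0 0 0 (inverse h0) ** M
           \<longleftrightarrow> (\<exists>s\<in>S. M = mat2 s 0 0 (inverse s))"
proof -
  obtain a b c d where M: "M = mat2 a b c d" "in_G a b c d"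
    using assms by (auto simp: G_def)
  have "h0 \<noteq> 0"
    using h0 by auto
  then have "inverse h0 \<noteq> h0"
    using h0(2) mult_self_eq_1 by (metis right_inverse)
  show ?thesis
  proof
    assume "M ** mat2 h0 0 0 (inverse h0) = mat2 h0 0 0 (inverse h0) ** M"
    then have "b = 0" "c = 0"
      using \<open>inverse h0 \<noteq> h0\<close> by (auto simp: M(1) mult.commute)
    moreover have "d = inverse a"
      using M(2) calculation by (metis in_G_def add.right_neutral mult_zero_left inverse_unique)
    moreover have "a \<in> S"
      using M(2) calculation by (auto simp: in_G_def intro!: S0_nonzero)
    ultimately show "\<exists>s\<in>S. M = mat2 s 0 0 (inverse s)"
      using M(1) by auto
  qed (auto simp: mult.commute)
qed

text \<open>An element of \<open>T_bar L T\<close> is coded by the diagonal matrix that acts as it;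
  its entry is the unique square root.\<close>

definition code :: "lt_sort \<Rightarrow> 'k \<Rightarrow> ('k^2^2) list" where
  "code s x = (case s of SortL \<Rightarrow> [mat2 1 x 0 1]
     | SortT \<Rightarrow> let t = inv_into UNIV (\<lambda>y. y\<^sup>2) x in [mat2 t 0 0 (inverse t)])"

lemma inj_square: "inj (\<lambda>y::'k. y\<^sup>2)"
  by (simp add: inj_def)

lemma code_simps [simp]:
  "code SortL x = [mat2 1 x 0 1]" "code SortT (y\<^sup>2) = [mat2 y 0 0 (inverse y)]"
  by (simp_all add: code_def inv_f_f[OF inj_square])

text \<open>Index 21 is \<open>b(1)\<close>, 22 a nontrivial element of \<open>T\<close>, 23 the
  Weyl element. The default \<open>a(1)\<close> serves as index 20 and supplies a value in
  \<open>G\<close> for every other index.\<close>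

definition param :: "unit \<Rightarrow> nat \<Rightarrow> 'k^2^2" where
  "param = (\<lambda>_ n. if n = 21 then mat2 1 0 1 1 else if n = 22 then mat2 h0 0 0 (inverse h0)
     else if n = 23 then mat2 0 1 1 0 else mat2 1 1 0 1)"

lemma param_G: "param s n \<in> G"
  using h0 by (auto simp: param_def in_G_a in_G_b in_G_diag) (simp add: in_G_def)

abbreviation GS :: "(unit, grp_op, 'k^2^2) fo_struct" where
  "GS \<equiv> group_struct (G_group L T)"

text \<open>With \<open>ex_commute_h\<close>, turns quantifiers over definable centralizers into
  quantifiers over \<open>L\<close> and \<open>S\<close>.\<close>

lemma ex_commute_b:
  "(\<exists>M\<in>G. M ** mat2 1 0 1 1 = mat2 1 0 1 1 ** M \<and> P M) \<longleftrightarrow> (\<exists>u\<in>L. P (mat2 1 0 u 1))"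
  using commute_b_iff in_G_b mat2_in_G by metis

lemma ex_commute_h:
  "(\<exists>M\<in>G. M ** mat2 h0 0 0 (inverse h0) = mat2 h0 0 0 (inverse h0) ** M \<and> P M)
     \<longleftrightarrow> (\<exists>s\<in>S. P (mat2 s 0 0 (inverse s)))"
  using commute_h_iff in_G_diag mat2_in_G by metis

text \<open>
  The product on the left is diagonal only for \<open>u = x\<inverse>\<close>, and then it is \<open>Diag x x\<inverse>\<close>, which
  conjugates \<open>a(1)\<close> to \<open>a(x\<^sup>2)\<close>.
\<close>

lemma square_via_conjugation:
  assumes "x \<in> L"
  shows "(\<exists>u\<in>L. \<exists>s\<in>S.
        mat2 1 x 0 1 ** mat2 1 0 u 1 ** mat2 1 x 0 1 ** mat2 0 1 1 0 = mat2 s 0 0 (inverse s) \<and>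
        mat2 s 0 0 (inverse s) ** mat2 1 1 0 1 = mat2 1 y 0 1 ** mat2 s 0 0 (inverse s))
    \<longleftrightarrow> x \<noteq> 0 \<and> y = x\<^sup>2"
proof -
  have prod: "mat2 1 x 0 1 ** mat2 1 0 u 1 ** mat2 1 x 0 1 ** mat2 0 1 1 0
      = mat2 (x\<^sup>2 * u) (x * u + 1) (x * u + 1) u" for u
    by (simp add: algebra_simps power2_eq_square two_eq_0)
  have conj: "mat2 s 0 0 (inverse s) ** mat2 1 1 0 1 = mat2 1 y 0 1 ** mat2 s 0 0 (inverse s)
      \<longleftrightarrow> y = s\<^sup>2" if "s \<in> S" for s
  proof -
    have "s \<noteq> 0" using that by auto
    then show ?thesis by (auto simp: field_simps power2_eq_square)
  qed
  show ?thesis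
  proof
    assume "\<exists>u\<in>L. \<exists>s\<in>S.
        mat2 1 x 0 1 ** mat2 1 0 u 1 ** mat2 1 x 0 1 ** mat2 0 1 1 0 = mat2 s 0 0 (inverse s) \<and>
        mat2 s 0 0 (inverse s) ** mat2 1 1 0 1 = mat2 1 y 0 1 ** mat2 s 0 0 (inverse s)"
    then obtain u s where "s \<in> S" and diag: "mat2 (x\<^sup>2 * u) (x * u + 1) (x * u + 1) u = mat2 s 0 0 (inverse s)"
      and "y = s\<^sup>2"
      unfolding prod using conj by blast
    from diag have "x\<^sup>2 * u = s" "x * u = 1"
      unfolding mat2_eq_iff add_eq_0_iff2 by blast+
    then have "s = x"
      by (metis mult.assoc mult.right_neutral power2_eq_square)
    then show "x \<noteq> 0 \<and> y = x\<^sup>2"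
      using \<open>s \<in> S\<close> \<open>y = s\<^sup>2\<close> by auto
  next
    assume h: "x \<noteq> 0 \<and> y = x\<^sup>2"
    \<comment> \<open>The inverse of \<open>x\<close> is \<open>x\<close> scaled by the square of
      its inverse.\<close>
    then have "inverse x \<in> L"
      using square_mult_L[OF assms, of "inverse x"] by (simp add: power2_eq_square mult.assoc)
    moreover have "x \<in> S"
      using assms h by (simp add: L_S)
    ultimately show "\<exists>u\<in>L. \<exists>s\<in>S.
        mat2 1 x 0 1 ** mat2 1 0 u 1 ** mat2 1 x 0 1 ** mat2 0 1 1 0 = mat2 s 0 0 (inverse s) \<and>
        mat2 s 0 0 (inverse s) ** mat2 1 1 0 1 = mat2 1 y 0 1 ** mat2 s 0 0 (inverse s)"
      using h unfolding prod
      by (intro bexI[of _ "inverse x"] bexI[of _ x] conjI)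
        (simp_all add: conj power2_eq_square mult.assoc)
  qed
qed

lemma LT_definable_in_G: "definable_in LT GS"
proof (rule definable_inI[where idx = "\<lambda>_. [()]" and \<phi> = code])
  fix s
  show "inj_on (code s) (univ LT s)"
    by (cases s) (auto simp: inj_on_def T_bar_eq)
  let ?\<phi> = "case s of SortL \<Rightarrow> commF 0 20 | SortT \<Rightarrow> commF 0 22"
  \<comment> \<open>Arbitrary further entries are allowed, so that the fact serves both the domain
    and the diagonal.\<close>
  have sat: "sat GS (assign (() # ss) (M # xs) param) ?\<phi> \<longleftrightarrow> [M] \<in> code s ` univ LT s"
    if "M \<in> G" "length ss < 20" for M ss xs
    using that
    by (cases s) (auto simp: assign_def nth_Cons' param_def commute_a_iff commute_h_iff T_bar_eq image_image)
  have sub: "code s ` univ LT s \<subseteq> tuples GS [()]"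
    by (cases s) (auto simp: tuples_def T_bar_eq in_G_a in_G_diag)
  have len1: "\<exists>M. code s x = [M]" for x
    by (cases s) (auto simp: code_def Let_def)
  show "definable GS [()] (code s ` univ LT s)"
  proof (rule definableI[where \<phi> = ?\<phi> and e = param])
    fix xs assume "xs \<in> tuples GS [()]"
    then obtain M where "xs = [M]" "M \<in> G"
      by (auto simp: tuples_def list_all2_Cons2)
    then show "xs \<in> code s ` univ LT s \<longleftrightarrow> sat GS (assign [()] xs param) ?\<phi>"
      using sat[of M "[]" "[]"] by simp
  qed (use param_G sub in \<open>auto split: lt_sort.split\<close>)
  show "definable GS ([()] @ [()]) ((\<lambda>x. code s x @ code s x) ` univ LT s)"
  proof (rule definableI[where \<phi> = "Conj ?\<phi> (Eq (vG 0) (vG 1))" and e = param])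
    show "(\<lambda>x. code s x @ code s x) ` univ LT s \<subseteq> tuples GS ([()] @ [()])"
      using sub by (auto simp: tuples_def simp del: LT_simps append_Cons append_Nil intro!: list_all2_appendI)
    fix xs assume "xs \<in> tuples GS ([()] @ [()])"
    then obtain M N where xs: "xs = [M, N]" "M \<in> G"
      by (auto simp: tuples_def list_all2_Cons2)
    have "xs \<in> (\<lambda>x. code s x @ code s x) ` univ LT s \<longleftrightarrow> [M] \<in> code s ` univ LT s \<and> M = N"
      unfolding xs using len1 by (auto simp: image_iff simp del: LT_simps) (metis append_Cons append_Nil list.inject)+
    then show "xs \<in> (\<lambda>x. code s x @ code s x) ` univ LT s
        \<longleftrightarrow> sat GS (assign ([()] @ [()]) xs param) (Conj ?\<phi> (Eq (vG 0) (vG 1)))"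
      using sat[of M "[()]" "[N]"] xs by (auto simp: assign_def simp del: LT_simps)
  qed (use param_G in \<open>auto split: lt_sort.split\<close>)
next
  fix f xs
  assume "list_all2 (\<lambda>x s. x \<in> univ LT s) xs (args LT f)"
  then show "interp LT f xs \<in> univ LT (res LT f)"
    by (cases f) (auto simp: list_all2_Cons2 T_bar_eq)
next
  fix f
  have add: "definable GS [(), (), ()] {[mat2 1 x 0 1, mat2 1 y 0 1, mat2 1 (x + y) 0 1] | x y. x \<in> L \<and> y \<in> L}"
    (is "definable _ _ ?X")
  proof (rule definableI[where e = param and
        \<phi> = "Conj (Conj (commF 0 20) (commF 1 20)) (Eq (vG 0 \<star> vG 1) (vG 2))"])
    fix xs assume "xs \<in> tuples GS [(), (), ()]"
    then show "xs \<in> ?X \<longleftrightarrow> sat GS (assign [(), (), ()] xs param)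
        (Conj (Conj (commF 0 20) (commF 1 20)) (Eq (vG 0 \<star> vG 1) (vG 2)))"
      by (auto simp: tuples_def list_all2_Cons2 assign_def param_def commute_a_iff add.commute)
  qed (auto simp: param_G tuples_def in_G_a)
  have act: "definable GS [(), (), ()]
      {[mat2 s 0 0 (inverse s), mat2 1 x 0 1, mat2 1 (s\<^sup>2 * x) 0 1] | s x. s \<in> S \<and> x \<in> L}"
    (is "definable _ _ ?X")
  \<comment> \<open>Conjugation is stated without inverses, as
    \<open>h a(x) = a(y) h\<close>.\<close>
  proof (rule definableI[where e = param and
        \<phi> = "Conj (Conj (commF 0 22) (Conj (commF 1 20) (commF 2 20))) (Eq (vG 0 \<star> vG 1) (vG 2 \<star> vG 0))"])
    fix xs assume "xs \<in> tuples GS [(), (), ()]"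
    then obtain M N P where xs: "xs = [M, N, P]" "M \<in> G" "N \<in> G" "P \<in> G"
      by (auto simp: tuples_def list_all2_Cons2)
    have *: "s * x = y * inverse s \<longleftrightarrow> y = s\<^sup>2 * x" if "s \<in> S" for s x y
    proof -
      have "s \<noteq> 0" using that by auto
      then show ?thesis by (auto simp: field_simps power2_eq_square)
    qed
    show "xs \<in> ?X \<longleftrightarrow> sat GS (assign [(), (), ()] xs param)
        (Conj (Conj (commF 0 22) (Conj (commF 1 20) (commF 2 20))) (Eq (vG 0 \<star> vG 1) (vG 2 \<star> vG 0)))"
      using xs by (auto simp: assign_def param_def commute_a_iff commute_h_iff *)
  qed (auto simp: param_G tuples_def in_G_a in_G_diag)
  have sq: "definable GS [(), ()] {[mat2 1 x 0 1, mat2 1 (x\<^sup>2) 0 1] | x. x \<in> L}"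
    (is "definable _ _ ?X")
  proof -
    let ?sq = "Ex () 30 (Conj (commF 30 21) (Ex () 31 (Conj (commF 31 22)
      (Conj (Eq (vG 0 \<star> vG 30 \<star> vG 0 \<star> vG 23) (vG 31)) (Eq (vG 31 \<star> vG 20) (vG 1 \<star> vG 31))))))"
    \<comment> \<open>For \<open>x = 0\<close> the formula \<open>?sq\<close> has no witnesses, so
      this case is separate; the identity is recognised as the only idempotent.\<close>
    let ?zero = "Conj (Eq (vG 0 \<star> vG 0) (vG 0)) (Eq (vG 1) (vG 0))"
    let ?\<phi> = "Conj (Conj (commF 0 20) (commF 1 20)) (Disj ?zero ?sq)"
    show ?thesis
    proof (rule definableI[where e = param and \<phi> = ?\<phi>])
      fix xs assume "xs \<in> tuples GS [(), ()]"
      then obtain M N where xs: "xs = [M, N]" "M \<in> G" "N \<in> G"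
        by (auto simp: tuples_def list_all2_Cons2)
      let ?e = "assign [(), ()] xs param"
      have e: "?e () 0 = M" "?e () (Suc 0) = N" "?e () 20 = mat2 1 1 0 1" "?e () 21 = mat2 1 0 1 1"
        "?e () 22 = mat2 h0 0 0 (inverse h0)" "?e () 23 = mat2 0 1 1 0"
        by (simp_all add: xs assign_def param_def)
      have sq: "sat GS ?e ?sq \<longleftrightarrow> (\<exists>u\<in>L. \<exists>s\<in>S.
          M ** mat2 1 0 u 1 ** M ** mat2 0 1 1 0 = mat2 s 0 0 (inverse s) \<and>
          mat2 s 0 0 (inverse s) ** mat2 1 1 0 1 = N ** mat2 s 0 0 (inverse s))"
        by (simp add: e ex_commute_b ex_commute_h del: mat2_mult)
      have cases: "sat GS ?e (Disj ?zero ?sq) \<longleftrightarrow> y = x\<^sup>2"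
        if "x \<in> L" "M = mat2 1 x 0 1" "N = mat2 1 y 0 1" for x y
      proof -
        have "sat GS ?e ?sq \<longleftrightarrow> x \<noteq> 0 \<and> y = x\<^sup>2"
          unfolding sq that(2,3) by (rule square_via_conjugation[OF that(1)])
        moreover have "sat GS ?e ?zero \<longleftrightarrow> x = 0 \<and> y = 0"
          by (auto simp: e that(2,3))
        ultimately show ?thesis
          unfolding sat_Disj by auto
      qed
      have "sat GS ?e ?\<phi> \<longleftrightarrow> (\<exists>x\<in>L. M = mat2 1 x 0 1) \<and> (\<exists>y\<in>L. N = mat2 1 y 0 1) \<and>
           sat GS ?e (Disj ?zero ?sq)"
        using xs(2,3) by (simp add: e commute_a_iff del: sat.simps(4) sat_Disj)
      also have "\<dots> \<longleftrightarrow> (\<exists>x\<in>L. M = mat2 1 x 0 1 \<and> N = mat2 1 (x\<^sup>2) 0 1)"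
        using cases square_L by blast
      also have "\<dots> \<longleftrightarrow> xs \<in> ?X"
        by (auto simp: xs)
      finally show "xs \<in> ?X \<longleftrightarrow> sat GS ?e ?\<phi>" by simp
    qed (auto simp: param_G tuples_def in_G_a)
  qed
  show "definable GS (concat (map (\<lambda>_. [()]) (args LT f)) @ [()])
        {concat (map2 code (args LT f) xs) @ code (res LT f) (interp LT f xs) | xs.
         list_all2 (\<lambda>x s. x \<in> univ LT s) xs (args LT f)}"
  proof (cases f)
    case Add
    then show ?thesis using add by (simp add: graph2[simplified])
  next
    case Act
    \<comment> \<open>Substituting the square of \<open>s\<close> for \<open>t\<close> matches this
      graph with \<open>act\<close>.\<close>
    have "{code SortT t @ [mat2 1 x 0 1, mat2 1 (t * x) 0 1] | t x. t \<in> T_bar L T \<and> x \<in> L}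
      = {[mat2 s 0 0 (inverse s), mat2 1 x 0 1, mat2 1 (s\<^sup>2 * x) 0 1] | s x. s \<in> S \<and> x \<in> L}"
      by (auto simp: T_bar_eq) force
    then show ?thesis using Act act by (simp add: graph2[simplified])
  next
    case Sq
    then show ?thesis using sq by (simp add: graph1[simplified])
  qed
qed

end

theorem theorem4p5:
  fixes L :: "'k::field set" and T :: "('k^2^2) set"
  assumes "imperfect_char2 TYPE('k)"
    and "is_add_subgroup L"
    and "range (\<lambda>x::'k. x\<^sup>2) \<subseteq> L"
    and "\<And>c x. c \<in> range (\<lambda>x::'k. x\<^sup>2) \<Longrightarrow> x \<in> L \<Longrightarrow> c * x \<in> L"
    and "subgroup T SL2"
    and "T_sub L \<subseteq> T" and "T \<subseteq> T_full"
  shows "definable_in (group_struct (G_group L T)) (LT_struct L (T_bar L T)) \<and>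
         definable_in (LT_struct L (T_bar L T)) (group_struct (G_group L T))"
proof -
  interpret subspace_char2 L T
    by (rule subspace_char2.intro[OF assms])
  show ?thesis
    using G_definable_in_LT LT_definable_in_G by simp
qed

end
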